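(* For all $m,n\in\mathbb{N}$ with $m\le n$, the following identity holds in $\mathbb{Q}[X,Z]$, where $\delta_{mn}=n-m$: $$\begin{aligned}&\sum_{w\in B_m}(-1)^{\mathrm{neg}(w)}X^{(\sigma_{mn}-\ell+2\,\mathrm{maj})(w)+\delta_{mn}(\mathrm{des}-\mathrm{neg})(w)}Z^{\mathrm{des}(w)}\\&\quad=\prod_{i=3}^{m}\left(1-X^{(m-i)(n+i)+2i+\delta_{mn}}Z\right)\\&\qquad\cdot\left(X^{2mn-m-n+1}Z^2-\left((X+1)X^m-(X^m-X-1)X^n-X\right)X^{mn-m-n}Z+1\right).\end{aligned}$$
   Context: $\mathbb{N}$ is the set of positive integers. $B_m$ is the group of permutations $w$ of $\{-m,\dots,0,\dots,m\}$ with $w(-i)=-w(i)$ for all $i$. Its Coxeter generators are $s_0=(-1,1)$ and $s_i=(-i-1,-i)(i,i+1)$ for $1\le i\le m-1$. $\ell(w)$ is the Coxeter length of $w$ with respect to these generators, and $D(w)=\{i\in\{0,\dots,m-1\}\mid\ell(ws_i)<\ell(w)\}$ is the (right) descent set, generators being identified with their indices. The statistics on $B_m$ are $$\mathrm{neg}(w)=\#\{i\in\{1,\dots,m\}\mid w(i)<0\},\quad \sigma_{mn}(w)=\sum_{i\in D(w)}(m-i)(n+i),\quad \mathrm{maj}(w)=\sum_{i\in D(w)}i,\quad \mathrm{des}(w)=|D(w)|.$$ A linear combination of statistics applied to $w$ means the same linear combination of their values at $w$.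
   Formalization: For m = 1 the product from i = 3 to 1 is read as the reciprocal of its i = 2 factor, i.e. 1/(1 − XZ), since the printed identity fails for m = 1 if that product is read as 1; for m ≥ 2 the formula is as printed. *)

theory Defs
  imports
    "HOL-Combinatorics.Combinatorics"
    "HOL-Computational_Algebra.Computational_Algebra"
begin

text \<open>
  Elements of B_m are total functions on the integers that fix every integer outside
  -m, ..., m, so that products in the group are compositions.
\<close>

definition hyperoct :: "nat \<Rightarrow> (int \<Rightarrow> int) set" where
  "hyperoct m = {w. w permutes {- int m..int m} \<and> (\<forall>i. w (- i) = - w i)}"

definition sgen :: "nat \<Rightarrow> int \<Rightarrow> int" where
  "sgen i = (if i = 0 then transpose (- 1) 1
     else transpose (- int i - 1) (- int i) \<circ> transpose (int i) (int i + 1))"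

definition word_prod :: "nat list \<Rightarrow> int \<Rightarrow> int" where
  "word_prod is = foldr (\<lambda>i w. sgen i \<circ> w) is id"

definition cox_length :: "nat \<Rightarrow> (int \<Rightarrow> int) \<Rightarrow> nat" where
  "cox_length m w =
     (LEAST k. \<exists>is. length is = k \<and> set is \<subseteq> {..<m} \<and> word_prod is = w)"

definition descents :: "nat \<Rightarrow> (int \<Rightarrow> int) \<Rightarrow> nat set" where
  "descents m w = {i \<in> {..<m}. cox_length m (w \<circ> sgen i) < cox_length m w}"

definition neg :: "nat \<Rightarrow> (int \<Rightarrow> int) \<Rightarrow> nat" where
  "neg m w = card {i \<in> {1..int m}. w i < 0}"

definition sigma :: "nat \<Rightarrow> nat \<Rightarrow> (int \<Rightarrow> int) \<Rightarrow> int" where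
  "sigma m n w = (\<Sum>i\<in>descents m w. (int m - int i) * (int n + int i))"

definition maj :: "nat \<Rightarrow> (int \<Rightarrow> int) \<Rightarrow> nat" where
  "maj m w = (\<Sum>i\<in>descents m w. i)"

definition des :: "nat \<Rightarrow> (int \<Rightarrow> int) \<Rightarrow> nat" where
  "des m w = card (descents m w)"

text \<open>
  Q[X,Z] is \<open>rat poly poly\<close>, with Z the outer and X the inner variable. Identities are
  stated in its fraction field Q(X,Z), in which X may carry a negative exponent.
\<close>

type_synonym ratfun = "rat poly poly fract"

definition QXZ :: "ratfun set" where
  "QXZ = range to_fract"

definition X :: ratfun where
  "X = to_fract [:[:0, 1:]:]"

definition Z :: ratfun where
  "Z = to_fract [:0, 1:]"

text \<open>
  Product from i = a to b, continued to b < a - 1 by the usual rule that the product from a to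
  b times the product from b + 1 to c is the product from a to c. It is the ordinary product
  for b \<ge> a - 1 (empty for b = a - 1), and the product from a to a - 2 is 1 / f (a - 1). The
  extension is needed for a product starting at i = 3 with upper limit m = 1: the identity
  to be stated fails for m = 1 if that product is read as 1, and holds with this reading.
\<close>

definition ext_prod :: "int \<Rightarrow> int \<Rightarrow> (int \<Rightarrow> 'a::field) \<Rightarrow> 'a" where
  "ext_prod a b f =
     (if a - 1 \<le> b then \<Prod>i=a..b. f i else inverse (\<Prod>i=b + 1..a - 1. f i))"

end

theory Submission
  imports Defs
begin

text \<open>
  Put q = 1/X and t = X^(m - n). Every summand is a product of a factor -t for each negative
  letter, q for each unit of length, and x_i = q^((i - 1)^2) t^i v for each descent i, where v is
  a monomial that we treat as a free variable, so that q, t, v no longer involve the degree m.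
  Let S_m(c) be the sum over those w in B_m with w(m) = c. Deleting the last letter changes the
  length and the number of negative letters by amounts that depend only on c, and creates a
  descent according to how c compares with the previous letter. This expresses S_(m+1) linearly in
  S_m. For m at least 3 only the letters c with absolute value at least m - 2 have
  S_m(c) nonzero, and these six values are explicit in terms of a quadratic Q_m in v, which as a
  function of m is a combination of 1, q^m and q^(2m). The linear recurrence of order three that
  follows drives the induction, and the sum over all of B_m is Q_m times the product of
  1 - x_i for i from 3 to m.
\<close>

section \<open>Length and descents of signed permutations\<close>

text \<open>Pairs range over the whole interval -m..m with 0 included, so inversions come in mirror
  pairs (i, j), (-j, -i), the pairs (-i, i) being their own mirror images. Swaps and sign changes
  are thus detected alike.\<close>

definition inversions :: "nat \<Rightarrow> (int \<Rightarrow> int) \<Rightarrow> (int \<times> int) set" where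
  "inversions m w = {(i, j). i \<in> {- int m..int m} \<and> j \<in> {- int m..int m} \<and> i < j \<and> w j < w i}"

lemma hyperoct_odd: "w \<in> hyperoct m \<Longrightarrow> w (- i) = - w i"
  by (simp add: hyperoct_def)

lemma hyperoct_0: "w \<in> hyperoct m \<Longrightarrow> w 0 = 0"
  using hyperoct_odd[of w m 0] by simp

lemma hyperoct_permutes: "w \<in> hyperoct m \<Longrightarrow> w permutes {- int m..int m}"
  by (simp add: hyperoct_def)

lemma hyperoct_eq_iff: "w \<in> hyperoct m \<Longrightarrow> w i = w j \<longleftrightarrow> i = j"
  by (auto dest!: hyperoct_permutes simp: permutes_inj inj_eq)

lemma hyperoct_bounded:
  assumes "w \<in> hyperoct m" "\<bar>i\<bar> \<le> int m"
  shows "\<bar>w i\<bar> \<le> int m"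
  using permutes_in_image[OF hyperoct_permutes[OF assms(1)], of i] assms(2) by auto

lemma hyperoct_comp: "v \<in> hyperoct m \<Longrightarrow> w \<in> hyperoct m \<Longrightarrow> v \<circ> w \<in> hyperoct m"
  by (auto simp: hyperoct_def intro: permutes_compose)

lemma finite_hyperoct: "finite (hyperoct m)"
  by (rule finite_subset[OF _ finite_permutations[of "{- int m..int m}"]])
    (auto simp: hyperoct_def)

lemma id_in_hyperoct: "id \<in> hyperoct m"
  by (simp add: hyperoct_def permutes_id)

section \<open>Generators and their effect on inversions\<close>

lemma sgen_simps:
  "sgen k i = (if k = 0 then (if i = 1 then - 1 else if i = - 1 then 1 else i)
     else if i = int k then int k + 1 else if i = int k + 1 then int k
     else if i = - int k then - int k - 1 else if i = - int k - 1 then - int k else i)"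
  by (auto simp: sgen_def transpose_def)

lemma sgen_sgen [simp]: "sgen k (sgen k i) = i"
  by (auto simp: sgen_simps)

lemma sgen_in_hyperoct:
  assumes "k < m"
  shows "sgen k \<in> hyperoct m"
proof -
  have "sgen k permutes {- int m..int m}"
  proof (rule bij_imp_permutes)
    show "bij_betw (sgen k) {- int m..int m} {- int m..int m}"
      by (rule bij_betw_byWitness[where f' = "sgen k"]) (use assms in \<open>auto simp: sgen_simps\<close>)
  qed (use assms in \<open>auto simp: sgen_simps\<close>)
  moreover have "sgen k (- i) = - sgen k i" for i
    by (auto simp: sgen_simps)
  ultimately show ?thesis
    by (simp add: hyperoct_def)
qed

lemma finite_inversions: "finite (inversions m w)"
  by (rule finite_subset[of _ "{- int m..int m} \<times> {- int m..int m}"]) (auto simp: inversions_def)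

text \<open>These are the pairs of positions whose order the k-th generator reverses.\<close>

definition wall_pairs :: "nat \<Rightarrow> (int \<times> int) set" where
  "wall_pairs k = (if k = 0 then {(- 1, 0), (0, 1), (- 1, 1)}
     else {(int k, int k + 1), (- int k - 1, - int k)})"

lemma sgen_mono_off_wall:
  assumes "i < j" "(i, j) \<notin> wall_pairs k"
  shows "sgen k i < sgen k j"
proof (cases "k = 0")
  case True
  then show ?thesis
    using assms by (simp add: sgen_simps wall_pairs_def) linarith
next
  case False
  then have "i = int k \<and> j = int k + 1 \<or> i = - int k - 1 \<and> j = - int k \<or> sgen k i < sgen k j"
    using assms(1) by (simp add: sgen_simps)
  then show ?thesis
    using False assms(2) by (auto simp: wall_pairs_def)
qed

lemma sgen_reverses_wall:
  assumes "(sgen k i, sgen k j) \<in> wall_pairs k"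
  shows "j < i"
proof -
  have "sgen k b < sgen k a" if "(a, b) \<in> wall_pairs k" for a b
    using that by (auto simp: wall_pairs_def sgen_simps split: if_splits)
  from this[OF assms] show ?thesis
    by simp
qed

text \<open>Off the wall, applying \<open>sgen k\<close> to both positions preserves their order and
  is an involution, so it matches the inversions of \<open>w \<circ> sgen k\<close> with those of
  w.\<close>

lemma card_inversions_off_wall:
  assumes "k < m"
  shows "card (inversions m (w \<circ> sgen k) - wall_pairs k) = card (inversions m w - wall_pairs k)"
proof -
  have s: "sgen k i \<in> {- int m..int m}" if "i \<in> {- int m..int m}" for i
    using permutes_in_image[OF hyperoct_permutes[OF sgen_in_hyperoct[OF assms]], of i] that by simp
  have *: "map_prod (sgen k) (sgen k) p \<in> inversions m v - wall_pairs k"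
    if "p \<in> inversions m (v \<circ> sgen k) - wall_pairs k" for p v
  proof (cases p)
    case (Pair i j)
    then show ?thesis
      using that s[of i] s[of j] sgen_mono_off_wall[of i j k] sgen_reverses_wall[of k i j]
      by (auto simp: inversions_def)
  qed
  have [simp]: "w \<circ> sgen k \<circ> sgen k = w"
    by (simp add: fun_eq_iff)
  show ?thesis
    by (rule bij_betw_same_card, rule bij_betw_byWitness[where f = "map_prod (sgen k) (sgen k)"
          and f' = "map_prod (sgen k) (sgen k)"])
      (use *[of _ w] *[of _ "w \<circ> sgen k"] in auto)
qed

lemma card_inversions_split:
  "card (inversions m w) = card (inversions m w - wall_pairs k) + card (inversions m w \<inter> wall_pairs k)"
  using card_Int_Diff[of "inversions m w" "wall_pairs k"] finite_inversions[of m w] by simp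

text \<open>As w is odd with \<open>w 0 = 0\<close>, the wall pairs are inverted all together or not
  at all; for k = 0 the sign of w(1) decides.\<close>

lemma inversions_on_wall:
  assumes "w \<in> hyperoct m" "k < m"
  shows "inversions m w \<inter> wall_pairs k = (if w (int k + 1) < w (int k) then wall_pairs k else {})"
  using assms(2) hyperoct_odd[OF assms(1), of "int k"] hyperoct_odd[OF assms(1), of "int k + 1"]
    hyperoct_0[OF assms(1)] hyperoct_odd[OF assms(1), of 1]
  by (auto simp: inversions_def wall_pairs_def)

lemma card_wall_pairs: "card (wall_pairs k) = (if k = 0 then 3 else 2)"
  by (simp add: wall_pairs_def)

lemma sgen_comp_less_iff:
  assumes "w \<in> hyperoct m" "k < m"
  shows "(w \<circ> sgen k) (int k + 1) < (w \<circ> sgen k) (int k) \<longleftrightarrow> w (int k) < w (int k + 1)"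
  using hyperoct_0[OF assms(1)] hyperoct_odd[OF assms(1), of 1]
  by (auto simp: sgen_simps)

lemma neg_comp_sgen_pos:
  assumes "k < m" "k \<noteq> 0"
  shows "neg m (w \<circ> sgen k) = neg m w"
  unfolding neg_def
  by (rule bij_betw_same_card, rule bij_betw_byWitness[where f = "sgen k" and f' = "sgen k"])
    (use assms in \<open>auto simp: sgen_simps\<close>)

text \<open>Position 1 is isolated because it is the only positive position whose letter changes
  under \<open>sgen 0\<close>.\<close>

lemma neg_split_1:
  assumes "0 < m"
  shows "neg m w = (if w 1 < 0 then 1 else 0) + card {i \<in> {2..int m}. w i < 0}"
proof -
  have "{i \<in> {1..int m}. w i < 0} = (if w 1 < 0 then {1} else {}) \<union> {i \<in> {2..int m}. w i < 0}"
    using assms by (auto simp: le_less)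
  moreover have "finite {i \<in> {2..int m}. w i < 0}"
    by (rule finite_subset[of _ "{2..int m}"]) auto
  ultimately show ?thesis
    unfolding neg_def by (simp only:) (subst card_Un_disjoint; simp)
qed

lemma neg_comp_sgen_0:
  assumes "w \<in> hyperoct m" "0 < m"
  shows "int (neg m (w \<circ> sgen 0)) = int (neg m w) + (if w 1 < 0 then - 1 else 1)"
proof -
  have "{i \<in> {2..int m}. (w \<circ> sgen 0) i < 0} = {i \<in> {2..int m}. w i < 0}"
    by (auto simp: sgen_simps)
  moreover have "w 1 \<noteq> 0"
    using hyperoct_eq_iff[OF assms(1), of 1 0] hyperoct_0[OF assms(1)] by simp
  ultimately show ?thesis
    using hyperoct_odd[OF assms(1), of 1]
    by (auto simp: neg_split_1[OF assms(2)] sgen_simps)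
qed

text \<open>For a negative letter at i > 0 the pairs (-i, 0), (0, i), (-i, i) are all inverted;
  discarding one of the three leaves two inversions per unit of length. Integer values avoid
  truncated subtraction.\<close>

definition twice_length :: "nat \<Rightarrow> (int \<Rightarrow> int) \<Rightarrow> int" where
  "twice_length m w = int (card (inversions m w)) - int (neg m w)"

lemma card_inversions_comp_sgen:
  assumes "w \<in> hyperoct m" "k < m"
  shows "int (card (inversions m (w \<circ> sgen k))) = int (card (inversions m w)) +
    (if w (int k + 1) < w (int k) then - 1 else 1) * int (card (wall_pairs k))"
proof -
  let ?v = "w \<circ> sgen k"
  let ?D = "w (int k + 1) < w (int k)"
  have v: "?v \<in> hyperoct m"
    by (rule hyperoct_comp[OF assms(1) sgen_in_hyperoct[OF assms(2)]])
  have "w (int k + 1) \<noteq> w (int k)"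
    using hyperoct_eq_iff[OF assms(1)] by simp
  then have flip: "?v (int k + 1) < ?v (int k) \<longleftrightarrow> \<not> ?D"
    unfolding sgen_comp_less_iff[OF assms] by linarith
  have "card (inversions m w \<inter> wall_pairs k) = (if ?D then card (wall_pairs k) else 0)"
    unfolding inversions_on_wall[OF assms] by simp
  moreover have "card (inversions m ?v \<inter> wall_pairs k) = (if ?D then 0 else card (wall_pairs k))"
    unfolding inversions_on_wall[OF v assms(2)] flip by simp
  ultimately show ?thesis
    unfolding card_inversions_split[of m w k] card_inversions_split[of m ?v k]
      card_inversions_off_wall[OF assms(2)]
    by (cases ?D) simp_all
qed

text \<open>For k > 0 the wall has two pairs and \<open>neg\<close> is unchanged. For k = 0 it has
  three, and \<open>neg\<close> moves by one in the same direction, so the net change is again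
  2.\<close>

lemma twice_length_comp_sgen:
  assumes "w \<in> hyperoct m" "k < m"
  shows "twice_length m (w \<circ> sgen k) =
    twice_length m w + (if w (int k + 1) < w (int k) then - 2 else 2)"
proof (cases "k = 0")
  case True
  then show ?thesis
    using card_inversions_comp_sgen[OF assms] neg_comp_sgen_0[OF assms(1)] assms(2)
      hyperoct_0[OF assms(1)]
    by (auto simp: twice_length_def card_wall_pairs)
next
  case False
  then show ?thesis
    using card_inversions_comp_sgen[OF assms] neg_comp_sgen_pos[OF assms(2), of w]
    by (auto simp: twice_length_def card_wall_pairs)
qed

text \<open>Strict increase from \<open>w 0 = 0\<close> gives w(k) \<ge> k, and descending from w(m)
  \<le> m gives w(k) \<le> k; oddness covers the negative positions.\<close>

lemma hyperoct_increasing_imp_id: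
  assumes w: "w \<in> hyperoct m" and incr: "\<And>k. k < m \<Longrightarrow> w (int k) < w (int k + 1)"
  shows "w = id"
proof -
  have lower: "int k \<le> w (int k)" if "k \<le> m" for k
    using that
  proof (induction k)
    case 0
    then show ?case
      using hyperoct_0[OF w] by simp
  next
    case (Suc k)
    have "int (Suc k) = int k + 1"
      by simp
    then show ?case
      using Suc incr[of k] by (simp only:) linarith
  qed
  have upper: "w (int (m - k)) \<le> int (m - k)" if "k \<le> m" for k
    using that
  proof (induction k)
    case 0
    then show ?case
      using hyperoct_bounded[OF w, of "int m"] by simp
  next
    case (Suc k)
    then have "int (m - Suc k) + 1 = int (m - k)"
      by linarith
    moreover have "w (int (m - Suc k)) < w (int (m - Suc k) + 1)"
      using Suc.prems by (intro incr) linarith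
    ultimately show ?case
      using Suc by (simp only:) linarith
  qed
  have nonneg: "w (int k) = int k" if "k \<le> m" for k
    using lower[OF that] upper[of "m - k"] that by simp
  have "w i = i" for i
  proof (cases "\<bar>i\<bar> \<le> int m")
    case True
    then show ?thesis
      using nonneg[of "nat i"] nonneg[of "nat (- i)"] hyperoct_odd[OF w, of i]
      by (cases "0 \<le> i") simp_all
  next
    case False
    then show ?thesis
      by (intro permutes_not_in[OF hyperoct_permutes[OF w]]) auto
  qed
  then show ?thesis
    by auto
qed

lemma twice_length_id: "twice_length m id = 0"
proof -
  have "inversions m id = {}" "{i \<in> {1..int m}. id i < 0} = {}"
    by (auto simp: inversions_def)
  then show ?thesis
    by (simp only: twice_length_def neg_def) simp
qed

section \<open>Words in the generators and the length formula\<close>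

lemma word_prod_Nil: "word_prod [] = id"
  by (simp add: word_prod_def)

lemma word_prod_snoc: "word_prod (is @ [k]) = word_prod is \<circ> sgen k"
proof -
  have "foldr (\<lambda>i w. sgen i \<circ> w) is v = foldr (\<lambda>i w. sgen i \<circ> w) is id \<circ> v" for v
    by (induction "is") (auto simp: comp_assoc)
  from this[of "sgen k"] show ?thesis
    by (simp add: word_prod_def)
qed

text \<open>Each letter changes \<open>twice_length\<close> by at most 2, which bounds the length of
  every word for w from below.\<close>

lemma twice_length_word_prod_le:
  assumes "set is \<subseteq> {..<m}"
  shows "word_prod is \<in> hyperoct m \<and> twice_length m (word_prod is) \<le> 2 * int (length is)"
  using assms
proof (induction "is" rule: rev_induct)
  case Nil
  then show ?case
    unfolding word_prod_Nil twice_length_id by (intro conjI id_in_hyperoct) simp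
next
  case (snoc k "is")
  then have IH: "word_prod is \<in> hyperoct m" "twice_length m (word_prod is) \<le> 2 * int (length is)"
    and k: "k < m"
    by auto
  have "twice_length m (word_prod is \<circ> sgen k) \<le> 2 * int (length (is @ [k]))"
    using twice_length_comp_sgen[OF IH(1) k] IH(2) by (auto split: if_splits)
  then show ?case
    unfolding word_prod_snoc
    by (intro conjI hyperoct_comp[OF IH(1) sgen_in_hyperoct[OF k]])
qed

text \<open>Sorting: a generator at a descent lowers the inversion count and takes exactly 2 off
  \<open>twice_length\<close>; once nothing descends, w is the identity.\<close>

lemma exists_reduced_word:
  assumes "w \<in> hyperoct m"
  shows "\<exists>is. set is \<subseteq> {..<m} \<and> word_prod is = w \<and> 2 * int (length is) = twice_length m w"
  using assms
proof (induction "card (inversions m w)" arbitrary: w rule: less_induct)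
  case less
  show ?case
  proof (cases "\<exists>k<m. w (int k + 1) < w (int k)")
    case True
    then obtain k where k: "k < m" "w (int k + 1) < w (int k)"
      by auto
    have "int (card (inversions m (w \<circ> sgen k))) < int (card (inversions m w))"
      using card_inversions_comp_sgen[OF less.prems k(1)] k(2) by (simp add: card_wall_pairs)
    then obtain "is" where "is": "set is \<subseteq> {..<m}" "word_prod is = w \<circ> sgen k"
      "2 * int (length is) = twice_length m (w \<circ> sgen k)"
      using less.hyps[of "w \<circ> sgen k"] hyperoct_comp[OF less.prems sgen_in_hyperoct[OF k(1)]]
      by (metis of_nat_less_iff)
    have "word_prod (is @ [k]) = w"
      by (simp add: word_prod_snoc "is"(2) fun_eq_iff)
    then show ?thesis
      using "is" k twice_length_comp_sgen[OF less.prems k(1)]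
      by (intro exI[of _ "is @ [k]"]) auto
  next
    case False
    have "w = id"
    proof (rule hyperoct_increasing_imp_id[OF less.prems])
      fix k assume "k < m"
      moreover have "w (int k + 1) \<noteq> w (int k)"
        using hyperoct_eq_iff[OF less.prems] by simp
      ultimately show "w (int k) < w (int k + 1)"
        using False by (meson linorder_neqE)
    qed
    then show ?thesis
      by (intro exI[of _ "[]"]) (simp add: word_prod_Nil twice_length_id)
  qed
qed

text \<open>The word obtained by sorting attains the lower bound valid for all words.\<close>

lemma twice_cox_length:
  assumes "w \<in> hyperoct m"
  shows "2 * int (cox_length m w) = twice_length m w"
proof -
  obtain "is" where "is": "set is \<subseteq> {..<m}" "word_prod is = w"
    "2 * int (length is) = twice_length m w"
    using exists_reduced_word[OF assms] by blast
  have "cox_length m w = length is"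
    unfolding cox_length_def
  proof (rule Least_equality)
    show "\<exists>js. length js = length is \<and> set js \<subseteq> {..<m} \<and> word_prod js = w"
      using "is" by blast
  next
    fix k assume "\<exists>js. length js = k \<and> set js \<subseteq> {..<m} \<and> word_prod js = w"
    then obtain js where "length js = k" "set js \<subseteq> {..<m}" "word_prod js = w"
      by blast
    then show "length is \<le> k"
      using twice_length_word_prod_le[of js m] "is"(3) by simp
  qed
  then show ?thesis
    using "is"(3) by simp
qed

text \<open>Right multiplication by a generator moves the length according to the order of two
  adjacent letters; at position 0 the comparison is of w(1) with \<open>w 0 = 0\<close>.\<close>

lemma descents_eq:
  assumes "w \<in> hyperoct m"
  shows "descents m w = {k. k < m \<and> w (int k + 1) < w (int k)}"
proof -
  have "cox_length m (w \<circ> sgen k) < cox_length m w \<longleftrightarrow> w (int k + 1) < w (int k)" if "k < m" for k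
    using twice_cox_length[OF assms] twice_length_comp_sgen[OF assms that]
      twice_cox_length[OF hyperoct_comp[OF assms sgen_in_hyperoct[OF that]]]
    by (auto split: if_splits)
  then show ?thesis
    by (auto simp: descents_def)
qed

section \<open>Splitting off the last letter\<close>

text \<open>Elements are total functions fixing everything outside their interval, so B_m is
  literally a subset of B_(m+1).\<close>

lemma hyperoct_Suc: "w \<in> hyperoct m \<Longrightarrow> w \<in> hyperoct (Suc m)"
  by (auto simp: hyperoct_def intro: permutes_subset)

definition last_letters :: "nat \<Rightarrow> int set" where
  "last_letters m = {- int m..int m} - {0}"

text \<open>
  This is the coset representative that sends m + 1 to c and is increasing on -m, ..., m. A signed
  permutation of degree m + 1 with last letter c factors uniquely as \<open>insert_last m c \<circ> w\<close> with w of
  degree m.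
\<close>

definition insert_last :: "nat \<Rightarrow> int \<Rightarrow> int \<Rightarrow> int" where
  "insert_last m c i =
     (if i = int m + 1 then c else if i = - int m - 1 then - c
      else if int m < \<bar>i\<bar> then i
      else if \<bar>c\<bar> \<le> i then i + 1 else if i \<le> - \<bar>c\<bar> then i - 1 else i)"

lemma insert_last_top [simp]: "insert_last m c (int m + 1) = c"
  by (simp add: insert_last_def)

lemma insert_last_bottom [simp]: "insert_last m c (- int m - 1) = - c"
  by (simp add: insert_last_def)

lemma insert_last_inner:
  assumes "\<bar>i\<bar> \<le> int m"
  shows "insert_last m c i = (if \<bar>c\<bar> \<le> i then i + 1 else if i \<le> - \<bar>c\<bar> then i - 1 else i)"
  using assms unfolding insert_last_def by auto

lemma insert_last_outer:
  assumes "int m + 1 < \<bar>i\<bar>"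
  shows "insert_last m c i = i"
  using assms unfolding insert_last_def by auto

lemma insert_last_odd:
  assumes "c \<noteq> 0"
  shows "insert_last m c (- i) = - insert_last m c i"
proof -
  consider "\<bar>i\<bar> \<le> int m" | "i = int m + 1" | "i = - int m - 1" | "int m + 1 < \<bar>i\<bar>"
    by linarith
  then show ?thesis
  proof cases
    case 1
    then show ?thesis
      using assms by (auto simp: insert_last_inner)
  next
    case 4
    then show ?thesis
      by (simp add: insert_last_outer)
  qed (simp_all add: insert_last_def)
qed

lemma insert_last_mono:
  assumes "\<bar>i\<bar> \<le> int m" "\<bar>j\<bar> \<le> int m" "i < j"
  shows "insert_last m c i < insert_last m c j"
  using assms(3) unfolding insert_last_inner[OF assms(1)] insert_last_inner[OF assms(2)]
  by auto

lemma insert_last_less_iff: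
  assumes "\<bar>i\<bar> \<le> int m" "\<bar>j\<bar> \<le> int m"
  shows "insert_last m c i < insert_last m c j \<longleftrightarrow> i < j"
  using insert_last_mono[OF assms, of c] insert_last_mono[OF assms(2,1), of c]
  by (metis less_asym linorder_neqE)

lemma insert_last_neg_iff:
  assumes "c \<noteq> 0" "\<bar>i\<bar> \<le> int m"
  shows "insert_last m c i < 0 \<longleftrightarrow> i < 0"
  using assms(1) unfolding insert_last_inner[OF assms(2)] by auto

text \<open>The value c itself is displaced, to c + 1 if c > 0 and to c - 1 if c < 0. Hence the weak
  comparison for positive and the strict one for negative c.\<close>

lemma insert_last_greater_iff:
  assumes "c \<noteq> 0" "\<bar>i\<bar> \<le> int m"
  shows "c < insert_last m c i \<longleftrightarrow> (if 0 < c then c \<le> i else c < i)"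
  using assms(1) unfolding insert_last_inner[OF assms(2)] by auto

lemma insert_last_neq:
  assumes "c \<noteq> 0" "\<bar>i\<bar> \<le> int m"
  shows "insert_last m c i \<noteq> c" "insert_last m c i \<noteq> - c"
  using assms(1) unfolding insert_last_inner[OF assms(2)] by auto

lemma last_letters_nonzero: "c \<in> last_letters m \<Longrightarrow> c \<noteq> 0"
  by (simp add: last_letters_def)

text \<open>The map is increasing on inner positions and avoids c and -c there, so it is injective
  on a finite set that it maps into itself.\<close>

lemma insert_last_in_hyperoct:
  assumes c: "c \<in> last_letters (Suc m)"
  shows "insert_last m c \<in> hyperoct (Suc m)"
proof -
  let ?A = "{- int (Suc m)..int (Suc m)}"
  have "insert_last m c permutes ?A"
  proof (rule bij_imp_permutes)
    have "insert_last m c i \<in> ?A" if "i \<in> ?A" for i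
    proof -
      have "\<bar>i\<bar> \<le> int m \<or> i = int m + 1 \<or> i = - int m - 1"
        using that by auto
      then show ?thesis
        using c by (elim disjE) (auto simp: insert_last_inner last_letters_def)
    qed
    then have into: "insert_last m c ` ?A \<subseteq> ?A"
      by blast
    have neq: "insert_last m c i \<noteq> insert_last m c j" if "i \<in> ?A" "j \<in> ?A" "i < j" for i j
    proof -
      have "(\<bar>i\<bar> \<le> int m \<or> i = - int m - 1) \<and> (\<bar>j\<bar> \<le> int m \<or> j = int m + 1)"
        using that by auto
      then show ?thesis
        using insert_last_mono[of i m j c] insert_last_neq[of c i m] insert_last_neq[of c j m]
          last_letters_nonzero[OF c] that(3)
        by auto
    qed
    have "inj_on (insert_last m c) ?A"
      by (rule inj_onI) (metis neq linorder_neqE)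
    then show "bij_betw (insert_last m c) ?A ?A"
      using endo_inj_surj[OF _ into] by (simp add: bij_betw_def)
  next
    fix i assume "i \<notin> ?A"
    then show "insert_last m c i = i"
      by (intro insert_last_outer) auto
  qed
  then show ?thesis
    using last_letters_nonzero[OF c] by (simp add: hyperoct_def insert_last_odd)
qed

lemma hyperoct_fixes_above:
  assumes "w \<in> hyperoct m"
  shows "w (int m + 1) = int m + 1"
  by (rule permutes_not_in[OF hyperoct_permutes[OF assms]]) simp

lemma hyperoct_last_letter:
  assumes "w \<in> hyperoct m" "0 < m"
  shows "w (int m) \<in> last_letters m"
  using hyperoct_bounded[OF assms(1), of "int m"] hyperoct_eq_iff[OF assms(1), of "int m" 0]
    hyperoct_0[OF assms(1)] assms(2)
  by (auto simp: last_letters_def)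

lemma hyperoct_inv:
  assumes "w \<in> hyperoct m"
  shows "inv w \<in> hyperoct m"
proof -
  note p = hyperoct_permutes[OF assms]
  have "inv w (- i) = - inv w i" for i
  proof -
    have "w (- inv w i) = - i"
      using hyperoct_odd[OF assms] permutes_inverses(1)[OF p] by simp
    then show ?thesis
      using permutes_inverses(2)[OF p] by metis
  qed
  then show ?thesis
    using permutes_inv[OF p] by (simp add: hyperoct_def)
qed

lemma hyperoct_Suc_fixing_top:
  assumes "w \<in> hyperoct (Suc m)" "w (int m + 1) = int m + 1"
  shows "w \<in> hyperoct m"
proof -
  have "w permutes {- int m..int m}"
    using hyperoct_permutes[OF assms(1)]
  proof (rule permutes_superset)
    fix i assume "i \<in> {- int (Suc m)..int (Suc m)} - {- int m..int m}"
    then have "i = int m + 1 \<or> i = - (int m + 1)"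
      by auto
    then show "w i = i"
      using assms(2) hyperoct_odd[OF assms(1), of "int m + 1"] by auto
  qed
  then show ?thesis
    using hyperoct_odd[OF assms(1)] by (simp add: hyperoct_def)
qed

lemma bij_betw_insert_last:
  assumes c: "c \<in> last_letters (Suc m)"
  shows "bij_betw (\<lambda>w. insert_last m c \<circ> w) (hyperoct m) {w \<in> hyperoct (Suc m). w (int (Suc m)) = c}"
proof (rule bij_betw_byWitness[where f' = "\<lambda>w. inv (insert_last m c) \<circ> w"])
  let ?u = "insert_last m c"
  note u = insert_last_in_hyperoct[OF c]
  note p = hyperoct_permutes[OF u]
  show "\<forall>w\<in>hyperoct m. inv ?u \<circ> (?u \<circ> w) = w"
    using permutes_inverses(2)[OF p] by (simp add: fun_eq_iff)
  show "\<forall>w\<in>{w \<in> hyperoct (Suc m). w (int (Suc m)) = c}. ?u \<circ> (inv ?u \<circ> w) = w"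
    using permutes_inverses(1)[OF p] by (simp add: fun_eq_iff)
  have top: "int (Suc m) = int m + 1"
    by simp
  show "(\<lambda>w. ?u \<circ> w) ` hyperoct m \<subseteq> {w \<in> hyperoct (Suc m). w (int (Suc m)) = c}"
    using hyperoct_comp[OF u hyperoct_Suc] unfolding top
    by (auto simp: hyperoct_fixes_above insert_last_top)
  have "inv ?u \<circ> w \<in> hyperoct m" if w: "w \<in> hyperoct (Suc m)" "w (int m + 1) = c" for w
  proof (rule hyperoct_Suc_fixing_top)
    show "inv ?u \<circ> w \<in> hyperoct (Suc m)"
      by (rule hyperoct_comp[OF hyperoct_inv[OF u] w(1)])
    have "?u (int m + 1) = c"
      by simp
    then show "(inv ?u \<circ> w) (int m + 1) = int m + 1"
      using w(2) permutes_inverses(2)[OF p, of "int m + 1"] by simp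
  qed
  then show "(\<lambda>w. inv ?u \<circ> w) ` {w \<in> hyperoct (Suc m). w (int (Suc m)) = c} \<subseteq> hyperoct m"
    by (auto simp: add.commute)
qed

text \<open>For an admissible last letter c this is the Coxeter length of the coset representative
  \<open>insert_last m c\<close>, as \<open>cox_length_insert_last\<close> shows for w the
  identity.\<close>

definition letters_above :: "nat \<Rightarrow> int \<Rightarrow> nat" where
  "letters_above m c = nat (if 0 < c then int m + 1 - c else int m - c)"

text \<open>Since w permutes the inner positions, the count depends only on the set of letters and
  is the same for all w.\<close>

lemma card_positions_above:
  assumes c: "c \<in> last_letters (Suc m)" and w: "w \<in> hyperoct m"
  shows "card {i \<in> {- int m..int m}. c < insert_last m c (w i)} = letters_above m c"
proof -
  let ?A = "{- int m..int m}"
  have wA: "w i \<in> ?A \<longleftrightarrow> i \<in> ?A" for i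
    using permutes_in_image[OF hyperoct_permutes[OF w]] .
  have "i \<in> ?A \<and> c < insert_last m c (w i) \<longleftrightarrow> w i \<in> ?A \<and> (if 0 < c then c \<le> w i else c < w i)" for i
    using insert_last_greater_iff[OF last_letters_nonzero[OF c], of "w i" m] wA[of i] by auto
  then have "{i \<in> ?A. c < insert_last m c (w i)} = w -` {d \<in> ?A. if 0 < c then c \<le> d else c < d}"
    by blast
  also have "{d \<in> ?A. if 0 < c then c \<le> d else c < d} = (if 0 < c then {c..int m} else {c + 1..int m})"
    using c by (auto simp: last_letters_def)
  also have "card (w -` \<dots>) = card (if 0 < c then {c..int m} else {c + 1..int m})"
    by (rule card_vimage_inj)
      (use permutes_inj[OF hyperoct_permutes[OF w]] permutes_surj[OF hyperoct_permutes[OF w]] in auto)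
  finally show ?thesis
    by (auto simp: letters_above_def)
qed

text \<open>Inner pairs keep their status because \<open>insert_last\<close> is increasing there.
  Pairs with the top position are inverted where the inner letter exceeds c, those with the bottom
  position are their mirror images, and the two ends are inverted when -c > c.\<close>

lemma inversions_insert_last:
  assumes c: "c \<in> last_letters (Suc m)" and w: "w \<in> hyperoct m"
  defines "R \<equiv> {i \<in> {- int m..int m}. c < insert_last m c (w i)}"
  shows "inversions (Suc m) (insert_last m c \<circ> w) = inversions m w \<union>
    (\<lambda>i. (i, int m + 1)) ` R \<union> (\<lambda>i. (- int m - 1, - i)) ` R \<union>
    (if c < 0 then {(- int m - 1, int m + 1)} else {})" (is "?L = ?R")
proof -
  let ?v = "insert_last m c \<circ> w"
  have top: "?v (int m + 1) = c"
    using hyperoct_fixes_above[OF w] by simp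
  have odd: "?v (- i) = - ?v i" for i
    using hyperoct_odd[OF w] insert_last_odd[OF last_letters_nonzero[OF c]] by simp
  have bot: "?v (- int m - 1) = - c"
    using odd[of "int m + 1"] top by simp
  have mid: "?v j < ?v i \<longleftrightarrow> w j < w i" if "\<bar>i\<bar> \<le> int m" "\<bar>j\<bar> \<le> int m" for i j
    using insert_last_less_iff[of "w j" m "w i" c] hyperoct_bounded[OF w] that by simp
  have "p \<in> ?L \<longleftrightarrow> p \<in> ?R" for p
  proof (cases p)
    case (Pair i j)
    consider "i < j" "\<bar>i\<bar> \<le> int m" "\<bar>j\<bar> \<le> int m" | "i = - int m - 1" "\<bar>j\<bar> \<le> int m"
      | "\<bar>i\<bar> \<le> int m" "j = int m + 1" | "i = - int m - 1" "j = int m + 1"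
      | "\<not> (i < j \<and> - int m - 1 \<le> i \<and> j \<le> int m + 1)"
      by linarith
    then show ?thesis
    proof cases
      case 1
      then show ?thesis
        using mid[of i j] Pair by (auto simp: inversions_def)
    next
      case 2
      have "(- int m - 1, j) \<in> (\<lambda>i. (- int m - 1, - i)) ` R \<longleftrightarrow> - j \<in> R"
        by force
      then show ?thesis
        using 2 odd[of j] bot Pair by (auto simp: inversions_def R_def)
    next
      case 3
      then show ?thesis
        using top Pair by (auto simp: inversions_def R_def)
    next
      case 4
      then show ?thesis
        using top bot Pair by (auto simp: inversions_def R_def)
    next
      case 5
      then show ?thesis
        using Pair by (auto simp: inversions_def R_def)
    qed
  qed
  then show ?thesis
    by blast
qed

lemma neg_insert_last:
  assumes c: "c \<in> last_letters (Suc m)" and w: "w \<in> hyperoct m"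
  shows "neg (Suc m) (insert_last m c \<circ> w) = neg m w + (if c < 0 then 1 else 0)"
proof -
  have "{i \<in> {1..int (Suc m)}. (insert_last m c \<circ> w) i < 0} =
      {i \<in> {1..int m}. w i < 0} \<union> (if c < 0 then {int m + 1} else {})" (is "?L = ?R")
  proof -
    have "i \<in> ?L \<longleftrightarrow> i \<in> ?R" for i
    proof (cases "i = int m + 1")
      case True
      then show ?thesis
        using hyperoct_fixes_above[OF w] by auto
    next
      case False
      then show ?thesis
        using insert_last_neg_iff[OF last_letters_nonzero[OF c], of "w i" m] hyperoct_bounded[OF w, of i] by auto
    qed
    then show ?thesis
      by blast
  qed
  moreover have "finite {i \<in> {1..int m}. w i < 0}"
    by (rule finite_subset[of _ "{1..int m}"]) auto
  ultimately show ?thesis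
    unfolding neg_def by (simp only:) (subst card_Un_disjoint; auto)
qed

text \<open>The larger letters are counted twice, at the top and mirrored at the bottom. For c < 0
  the inversion between the two ends is offset by the new negative letter.\<close>

lemma cox_length_insert_last:
  assumes c: "c \<in> last_letters (Suc m)" and w: "w \<in> hyperoct m"
  shows "cox_length (Suc m) (insert_last m c \<circ> w) = cox_length m w + letters_above m c"
proof -
  define R where "R = {i \<in> {- int m..int m}. c < insert_last m c (w i)}"
  have [simp]: "finite R"
    unfolding R_def by (rule finite_subset[of _ "{- int m..int m}"]) auto
  have R: "\<bar>i\<bar> \<le> int m" if "i \<in> R" for i
    using that by (auto simp: R_def)
  have inv_bound: "\<bar>fst p\<bar> \<le> int m \<and> \<bar>snd p\<bar> \<le> int m" if "p \<in> inversions m w" for p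
    using that by (auto simp: inversions_def)
  let ?S = "if c < 0 then {(- int m - 1, int m + 1)} else {}"
  have "card (inversions (Suc m) (insert_last m c \<circ> w)) =
      card (inversions m w \<union> (\<lambda>i. (i, int m + 1)) ` R \<union> (\<lambda>i. (- int m - 1, - i)) ` R) + card ?S"
    unfolding inversions_insert_last[OF c w] R_def[symmetric]
    by (rule card_Un_disjoint)
      (use finite_inversions in \<open>auto dest: R inv_bound\<close>)
  also have "card (inversions m w \<union> (\<lambda>i. (i, int m + 1)) ` R \<union> (\<lambda>i. (- int m - 1, - i)) ` R) =
      card (inversions m w \<union> (\<lambda>i. (i, int m + 1)) ` R) + card ((\<lambda>i. (- int m - 1, - i)) ` R)"
    by (rule card_Un_disjoint) (use \<open>finite R\<close> finite_inversions in \<open>auto dest: R inv_bound\<close>)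
  also have "card (inversions m w \<union> (\<lambda>i. (i, int m + 1)) ` R) =
      card (inversions m w) + card ((\<lambda>i. (i, int m + 1)) ` R)"
    by (rule card_Un_disjoint) (use \<open>finite R\<close> finite_inversions in \<open>auto dest: R inv_bound\<close>)
  also have "card ((\<lambda>i. (i, int m + 1)) ` R) = card R"
    by (rule card_image) (auto simp: inj_on_def)
  also have "card ((\<lambda>i. (- int m - 1, - i)) ` R) = card R"
    by (rule card_image) (auto simp: inj_on_def)
  also have "card R = letters_above m c"
    unfolding R_def by (rule card_positions_above[OF c w])
  finally have card: "card (inversions (Suc m) (insert_last m c \<circ> w)) =
      card (inversions m w) + letters_above m c + letters_above m c + card ?S" .
  have "twice_length (Suc m) (insert_last m c \<circ> w) =
      twice_length m w + 2 * int (letters_above m c)"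
    unfolding twice_length_def neg_insert_last[OF c w] card by simp
  then show ?thesis
    using twice_cox_length[OF w]
      twice_cox_length[OF hyperoct_comp[OF insert_last_in_hyperoct[OF c] hyperoct_Suc[OF w]]]
    by linarith
qed

lemma descents_insert_last:
  assumes c: "c \<in> last_letters (Suc m)" and w: "w \<in> hyperoct m"
  shows "descents (Suc m) (insert_last m c \<circ> w) =
    descents m w \<union> (if (if 0 < c then c \<le> w (int m) else c < w (int m)) then {m} else {})"
proof -
  let ?v = "insert_last m c \<circ> w"
  have "k < Suc m \<and> ?v (int k + 1) < ?v (int k) \<longleftrightarrow> k < m \<and> w (int k + 1) < w (int k) \<or>
      k = m \<and> (if 0 < c then c \<le> w (int m) else c < w (int m))" for k
  proof (cases "k < m")
    case True
    then show ?thesis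
      using insert_last_less_iff[of "w (int k + 1)" m "w (int k)" c] hyperoct_bounded[OF w]
      by simp
  next
    case False
    then show ?thesis
      using insert_last_greater_iff[OF last_letters_nonzero[OF c] hyperoct_bounded[OF w, of "int m"]]
        hyperoct_fixes_above[OF w]
      by (cases "k = m") auto
  qed
  then show ?thesis
    unfolding descents_eq[OF w]
      descents_eq[OF hyperoct_comp[OF insert_last_in_hyperoct[OF c] hyperoct_Suc[OF w]]]
    by auto
qed

section \<open>Weights and the recursion for sums with prescribed last letter\<close>

definition weight :: "'a \<Rightarrow> 'a \<Rightarrow> (nat \<Rightarrow> 'a) \<Rightarrow> nat \<Rightarrow> (int \<Rightarrow> int) \<Rightarrow> 'a::comm_ring_1" where
  "weight y q x m w = y ^ neg m w * q ^ cox_length m w * (\<Prod>i\<in>descents m w. x i)"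

lemma weight_insert_last:
  assumes c: "c \<in> last_letters (Suc m)" and w: "w \<in> hyperoct m"
  shows "weight y q x (Suc m) (insert_last m c \<circ> w) =
    (if c < 0 then y else 1) * q ^ letters_above m c *
      (weight y q x m w * (if (if 0 < c then c \<le> w (int m) else c < w (int m)) then x m else 1))"
proof -
  have "finite (descents m w)" "m \<notin> descents m w"
    by (auto simp: descents_def)
  then show ?thesis
    by (simp add: weight_def neg_insert_last[OF c w] cox_length_insert_last[OF c w]
        descents_insert_last[OF c w] power_add)
qed

definition last_sum :: "'a \<Rightarrow> 'a \<Rightarrow> (nat \<Rightarrow> 'a) \<Rightarrow> nat \<Rightarrow> int \<Rightarrow> 'a::comm_ring_1" where
  "last_sum y q x m c = (\<Sum>w | w \<in> hyperoct m \<and> w (int m) = c. weight y q x m w)"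

text \<open>The function f is left free: a descent factor in its place gives the recursion, f = 1
  gives the total.\<close>

lemma sum_weight_by_last:
  "(\<Sum>w\<in>hyperoct m. weight y q x m w * f (w (int m))) =
    (\<Sum>d\<in>{- int m..int m}. last_sum y q x m d * f d)"
proof -
  have last: "w (int m) \<in> {- int m..int m}" if "w \<in> hyperoct m" for w
    using hyperoct_bounded[OF that, of "int m"] by auto
  have "(\<Sum>d\<in>{- int m..int m}. last_sum y q x m d * f d) =
      (\<Sum>d\<in>{- int m..int m}. \<Sum>w | w \<in> hyperoct m \<and> w (int m) = d. weight y q x m w * f (w (int m)))"
    unfolding last_sum_def sum_distrib_right by (intro sum.cong refl) auto
  also have "\<dots> = (\<Sum>w\<in>hyperoct m. weight y q x m w * f (w (int m)))"
    by (rule sum.group[OF finite_hyperoct]) (use last in auto)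
  finally show ?thesis ..
qed

text \<open>Restoring the last letter multiplies the weight by a factor that depends only on c and
  the previous letter d, so the sum can be grouped by d.\<close>

lemma last_sum_Suc:
  assumes c: "c \<in> last_letters (Suc m)"
  shows "last_sum y q x (Suc m) c = (if c < 0 then y else 1) * q ^ letters_above m c *
    (\<Sum>d\<in>{- int m..int m}. last_sum y q x m d * (if (if 0 < c then c \<le> d else c < d) then x m else 1))"
proof -
  have "last_sum y q x (Suc m) c = (\<Sum>w\<in>hyperoct m. weight y q x (Suc m) (insert_last m c \<circ> w))"
    unfolding last_sum_def
    by (rule sum.reindex_bij_betw[OF bij_betw_insert_last[OF c], symmetric])
  also have "\<dots> = (\<Sum>w\<in>hyperoct m. (if c < 0 then y else 1) * q ^ letters_above m c *
      (weight y q x m w * (if (if 0 < c then c \<le> w (int m) else c < w (int m)) then x m else 1)))"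
    by (intro sum.cong refl weight_insert_last[OF c])
  also have "\<dots> = (if c < 0 then y else 1) * q ^ letters_above m c *
    (\<Sum>d\<in>{- int m..int m}. last_sum y q x m d * (if (if 0 < c then c \<le> d else c < d) then x m else 1))"
    unfolding sum_distrib_left[symmetric]
    by (subst sum_weight_by_last[symmetric]) simp
  finally show ?thesis .
qed

lemma last_sum_outside:
  assumes "0 < m" "c \<notin> last_letters m"
  shows "last_sum y q x m c = 0"
proof -
  have "{w. w \<in> hyperoct m \<and> w (int m) = c} = {}"
    using hyperoct_last_letter[OF _ assms(1)] assms(2) by auto
  then show ?thesis
    by (simp only: last_sum_def sum.empty)
qed

text \<open>Start of the recursion: in degree 0 the last position is 0 with letter 0, so a descent
  at position 0 is handled like all others.\<close>

lemma last_sum_0: "last_sum y q x 0 0 = 1"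
proof -
  have "w = id" if "w \<in> hyperoct 0" for w
    by (rule hyperoct_increasing_imp_id[OF that]) simp
  then have "{w. w \<in> hyperoct 0 \<and> w (int 0) = 0} = {id}"
    using id_in_hyperoct hyperoct_0 by auto
  moreover have "cox_length 0 id = 0" "neg 0 id = 0" "descents 0 id = {}"
    using twice_cox_length[OF id_in_hyperoct, of 0] twice_length_id[of 0]
    by (auto simp: neg_def descents_def)
  ultimately show ?thesis
    by (simp only: last_sum_def weight_def) simp
qed

section \<open>The sums for the distinguished weights\<close>

text \<open>The square is formed over the integers so that the exponent of q at i = 0 is 1;
  truncated subtraction would make it 0.\<close>

definition step_var :: "'a \<Rightarrow> 'a \<Rightarrow> 'a \<Rightarrow> nat \<Rightarrow> 'a::comm_ring_1" where
  "step_var q t v i = q ^ nat ((int i - 1)\<^sup>2) * t ^ i * v"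

text \<open>The substitution in \<open>quad_factor_X\<close> turns this into the quadratic in Z of
  the theorem.\<close>

definition quad_factor :: "'a \<Rightarrow> 'a \<Rightarrow> 'a \<Rightarrow> nat \<Rightarrow> 'a::comm_ring_1" where
  "quad_factor q t v m =
     1 - v * t * ((1 + q) * (1 + t) * q ^ m - q - t * q ^ (2 * m)) + v\<^sup>2 * t ^ 3 * q ^ (2 * m + 1)"

text \<open>Consecutive squares differ by an odd number; \<open>0 < m\<close> keeps the natural
  subtraction exact.\<close>

lemma step_var_Suc:
  assumes "0 < m"
  shows "step_var q t v (Suc m) = step_var q t v m * q ^ (2 * m - 1) * t"
proof -
  have "nat ((int (Suc m) - 1)\<^sup>2) = nat ((int m - 1)\<^sup>2 + int (2 * m - 1))"
    using assms by (simp add: power2_eq_square algebra_simps of_nat_diff)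
  also have "\<dots> = nat ((int m - 1)\<^sup>2) + (2 * m - 1)"
    by (subst nat_add_distrib) simp_all
  finally show ?thesis
    by (simp add: step_var_def power_add algebra_simps)
qed

lemma step_var_numeral:
  "step_var q t v 0 = q * v" "step_var q t v 1 = t * v" "step_var q t v 2 = q * t\<^sup>2 * v"
  "step_var q t v 3 = q ^ 4 * t ^ 3 * v"
  by (simp_all add: step_var_def)

text \<open>As a function of m, \<open>quad_factor\<close> is a combination of 1, q^m and q^(2 m).\<close>

lemma quad_factor_recurrence:
  "quad_factor q t v (k + 3) = (1 + q + q\<^sup>2) * quad_factor q t v (k + 2)
     - (q + q\<^sup>2 + q ^ 3) * quad_factor q t v (k + 1) + q ^ 3 * quad_factor q t v k"
  unfolding quad_factor_def power_add power_mult
  by (simp add: power_mult_distrib power2_eq_square power3_eq_cube algebra_simps)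

context
  fixes q t v :: "'a::comm_ring_1"
begin

private abbreviation "xs \<equiv> step_var q t v"
private abbreviation "S \<equiv> last_sum (- t) q xs"
private abbreviation "Q \<equiv> quad_factor q t v"

definition total :: "nat \<Rightarrow> 'a" where
  "total m = (\<Sum>d\<in>{- int m..int m}. S m d)"

lemma atLeastAtMost_int_expand:
  "{- 1..1::int} = {- 1, 0, 1}" "{- 2..2::int} = {- 2, - 1, 0, 1, 2}"
  by auto

text \<open>Two rounds of the recursion from degree 0 supply the data for the base case and for the
  small totals.\<close>

lemma last_sum_small:
  "S 1 1 = 1" "S 1 (- 1) = - t * q * xs 0"
  "S 2 2 = 1 - t * q * xs 0" "S 2 1 = q * (xs 1 - t * q * xs 0)"
  "S 2 (- 1) = - t * q\<^sup>2 * (xs 1 - t * q * xs 0)"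
  "S 2 (- 2) = - t * q ^ 3 * xs 1 * (1 - t * q * xs 0)"
proof -
  show 1: "S 1 1 = 1" "S 1 (- 1) = - t * q * xs 0"
    using last_sum_Suc[of 1 0 "- t" q xs] last_sum_Suc[of "- 1" 0 "- t" q xs]
    by (simp_all add: last_letters_def letters_above_def last_sum_0)
  have 0: "S 1 0 = 0" "Suc 1 = 2"
    by (simp_all add: last_sum_outside last_letters_def)
  show "S 2 2 = 1 - t * q * xs 0" "S 2 1 = q * (xs 1 - t * q * xs 0)"
    "S 2 (- 1) = - t * q\<^sup>2 * (xs 1 - t * q * xs 0)"
    "S 2 (- 2) = - t * q ^ 3 * xs 1 * (1 - t * q * xs 0)"
    using last_sum_Suc[of 2 1 "- t" q xs] last_sum_Suc[of 1 1 "- t" q xs]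
      last_sum_Suc[of "- 1" 1 "- t" q xs] last_sum_Suc[of "- 2" 1 "- t" q xs]
    unfolding 0(2)
    by (simp_all add: last_letters_def letters_above_def atLeastAtMost_int_expand 0 1 del: One_nat_def)
      (simp_all add: eval_nat_numeral algebra_simps)
qed

text \<open>
  The sums over signed permutations with last letter c vanish for all but the six extreme values of
  c: the weights are such that the cases "descent" and "ascent" at the last position cancel for a
  middle letter. P stands for the product of the \<open>1 - xs i\<close> with i from 3 to k + 2.
\<close>

definition top_sums_formula :: "nat \<Rightarrow> 'a \<Rightarrow> bool" where
  "top_sums_formula k P \<longleftrightarrow>
    S (k + 3) (int k + 3) = P * Q (k + 2) \<and>
    S (k + 3) (int k + 2) = q * P * (Q (k + 2) - Q (k + 1)) \<and>
    S (k + 3) (int k + 1) = q\<^sup>2 * P * (Q (k + 2) - Q (k + 1) - q * (Q (k + 1) - Q k)) \<and>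
    S (k + 3) (- int k - 3) = - q\<^sup>2 * xs (k + 3) * P * Q (k + 2) \<and>
    S (k + 3) (- int k - 2) = - q * xs (k + 3) * P * (Q (k + 2) - q\<^sup>2 * Q (k + 1)) \<and>
    S (k + 3) (- int k - 1) =
      - xs (k + 3) * P * (Q (k + 2) - q\<^sup>2 * Q (k + 1) - q * (Q (k + 1) - q\<^sup>2 * Q k)) \<and>
    (\<forall>c. \<bar>c\<bar> \<le> int k \<longrightarrow> S (k + 3) c = 0)"

text \<open>In degree 3 the six extreme letters are all the nonzero ones and P is an empty product;
  what remains are polynomial identities in q, t and v.\<close>

lemma top_sums_formula_0: "top_sums_formula 0 1"
proof -
  have 0: "S 2 0 = 0" "S 3 0 = 0" "Suc 2 = 3"
    by (simp_all add: last_sum_outside last_letters_def)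
  have "S 3 c = (if c < 0 then - t else 1) * q ^ letters_above 2 c *
    (\<Sum>d\<in>{- 2, - 1, 0, 1, 2}. S 2 d * (if (if 0 < c then c \<le> d else c < d) then xs 2 else 1))"
    if "c \<in> {- 3, - 2, - 1, 1, 2, 3}" for c
    using last_sum_Suc[of c 2 "- t" q xs] that unfolding 0(3)
    by (auto simp: last_letters_def atLeastAtMost_int_expand)
  from this[of 3] this[of 2] this[of 1] this[of "- 1"] this[of "- 2"] this[of "- 3"] show ?thesis
    unfolding top_sums_formula_def
    by (simp add: letters_above_def 0 last_sum_small step_var_numeral quad_factor_def del: One_nat_def)
       (simp add: eval_nat_numeral algebra_simps)
qed

lemma sum_top_sums:
  assumes "top_sums_formula k P"
  shows "(\<Sum>d\<in>{- int (k + 3)..int (k + 3)}. S (k + 3) d * f d) =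
    S (k + 3) (int k + 3) * f (int k + 3) + S (k + 3) (int k + 2) * f (int k + 2)
    + S (k + 3) (int k + 1) * f (int k + 1) + S (k + 3) (- int k - 3) * f (- int k - 3)
    + S (k + 3) (- int k - 2) * f (- int k - 2) + S (k + 3) (- int k - 1) * f (- int k - 1)"
proof -
  let ?B = "{int k + 3, int k + 2, int k + 1, - int k - 3, - int k - 2, - int k - 1}"
  have zero: "S (k + 3) c = 0" if "\<bar>c\<bar> \<le> int k" for c
    using assms that by (simp add: top_sums_formula_def)
  have "(\<Sum>d\<in>{- int (k + 3)..int (k + 3)}. S (k + 3) d * f d) = (\<Sum>d\<in>?B. S (k + 3) d * f d)"
  proof (rule sum.mono_neutral_right)
    show "\<forall>d\<in>{- int (k + 3)..int (k + 3)} - ?B. S (k + 3) d * f d = 0"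
    proof
      fix d assume "d \<in> {- int (k + 3)..int (k + 3)} - ?B"
      then have "\<bar>d\<bar> \<le> int k"
        by auto
      then show "S (k + 3) d * f d = 0"
        using zero by simp
    qed
  qed auto
  also have "\<dots> = S (k + 3) (int k + 3) * f (int k + 3) + S (k + 3) (int k + 2) * f (int k + 2)
    + S (k + 3) (int k + 1) * f (int k + 1) + S (k + 3) (- int k - 3) * f (- int k - 3)
    + S (k + 3) (- int k - 2) * f (- int k - 2) + S (k + 3) (- int k - 1) * f (- int k - 1)"
    by (simp add: add.assoc)
  finally show ?thesis .
qed

text \<open>In the recursion each of the six surviving letters d carries a factor 1 or
  \<open>xs (k + 3)\<close>, so every new sum is a short polynomial in the old ones; the recurrence
  for \<open>Q\<close> brings it to the claimed form.\<close>

lemma top_sums_formula_Suc: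
  assumes F: "top_sums_formula k P"
  shows "top_sums_formula (Suc k) (P * (1 - xs (k + 3)))"
proof -
  define y where "y = xs (k + 3)"
  define A where "A = Q (k + 2)"
  define B where "B = Q (k + 1)"
  define C where "C = Q k"
  \<comment> \<open>The characteristic roots of this recurrence are 1, q and q^2. It eliminates
    \<open>Q (k + 3)\<close> in favour of A, B and C.\<close>
  have D: "Q (k + 3) = (1 + q + q\<^sup>2) * A - (q + q\<^sup>2 + q ^ 3) * B + q ^ 3 * C"
    unfolding A_def B_def C_def by (rule quad_factor_recurrence)
  \<comment> \<open>The exponent 2 (k + 3) - 1 comes from \<open>step_var_Suc\<close>; the same
    power of q divides the length factor of each of the three extreme negative letters.\<close>
  define r where "r = q ^ (2 * k + 5)"
  have y': "xs (k + 4) = y * r * t"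
    using step_var_Suc[of "k + 3" q t v] by (simp add: y_def r_def eval_nat_numeral)
  have step: "S (k + 4) c = (if c < 0 then - t else 1) * q ^ letters_above (k + 3) c *
     (P * A * (if (if 0 < c then c \<le> int k + 3 else c < int k + 3) then y else 1)
      + q * P * (A - B) * (if (if 0 < c then c \<le> int k + 2 else c < int k + 2) then y else 1)
      + q\<^sup>2 * P * (A - B - q * (B - C)) * (if (if 0 < c then c \<le> int k + 1 else c < int k + 1) then y else 1)
      - q\<^sup>2 * y * P * A * (if (if 0 < c then c \<le> - int k - 3 else c < - int k - 3) then y else 1)
      - q * y * P * (A - q\<^sup>2 * B) * (if (if 0 < c then c \<le> - int k - 2 else c < - int k - 2) then y else 1)
      - y * P * (A - q\<^sup>2 * B - q * (B - q\<^sup>2 * C))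
          * (if (if 0 < c then c \<le> - int k - 1 else c < - int k - 1) then y else 1))"
    if "c \<in> last_letters (k + 4)" for c
  proof -
    have "S (Suc (k + 3)) c = (if c < 0 then - t else 1) * q ^ letters_above (k + 3) c *
      (\<Sum>d\<in>{- int (k + 3)..int (k + 3)}. S (k + 3) d *
        (if (if 0 < c then c \<le> d else c < d) then xs (k + 3) else 1))"
      by (rule last_sum_Suc) (use that in \<open>simp add: eval_nat_numeral\<close>)
    also note sum_top_sums[OF F]
    finally show ?thesis
      using F by (simp add: top_sums_formula_def y_def A_def B_def C_def eval_nat_numeral)
  qed
  have letters: "c \<in> last_letters (k + 4) \<longleftrightarrow> c \<noteq> 0 \<and> \<bar>c\<bar> \<le> int k + 4" for c
    by (auto simp: last_letters_def)
  \<comment> \<open>No d reaches k + 4, so no factor y arises and this is the whole sum of degree k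
    + 3. Each of the next two letters turns one more d into a descent.\<close>
  have 1: "S (k + 4) (int k + 4) = P * (1 - y) * Q (k + 3)"
    using step[of "int k + 4"] unfolding D
    by (simp add: letters letters_above_def) (simp add: eval_nat_numeral algebra_simps)
  have 2: "S (k + 4) (int k + 3) = q * (P * (1 - y)) * (Q (k + 3) - A)"
    using step[of "int k + 3"] unfolding D
    by (simp add: letters letters_above_def) (simp add: eval_nat_numeral algebra_simps)
  have 3: "S (k + 4) (int k + 2) = q\<^sup>2 * (P * (1 - y)) * (Q (k + 3) - A - q * (A - B))"
    using step[of "int k + 2"] unfolding D
    by (simp add: letters letters_above_def) (simp add: eval_nat_numeral algebra_simps)
  have "letters_above (k + 3) (- int k - 4) = 2 * k + 5 + 2"
    "letters_above (k + 3) (- int k - 3) = 2 * k + 5 + 1"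
    "letters_above (k + 3) (- int k - 2) = 2 * k + 5"
    by (auto simp: letters_above_def)
  then have pow: "q ^ letters_above (k + 3) (- int k - 4) = r * q\<^sup>2"
    "q ^ letters_above (k + 3) (- int k - 3) = r * q"
    "q ^ letters_above (k + 3) (- int k - 2) = r"
    by (simp_all only: power_add r_def power_one_right)
  \<comment> \<open>Every d exceeds c here, so y appears throughout; the next two letters lose it at
    d = -k - 3, then also at d = -k - 2.\<close>
  have 4: "S (k + 4) (- int k - 4) = - q\<^sup>2 * (y * r * t) * (P * (1 - y)) * Q (k + 3)"
    using step[of "- int k - 4"] unfolding D pow
    by (simp add: letters) (simp add: eval_nat_numeral algebra_simps)
  have 5: "S (k + 4) (- int k - 3) = - q * (y * r * t) * (P * (1 - y)) * (Q (k + 3) - q\<^sup>2 * A)"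
    using step[of "- int k - 3"] unfolding D pow
    by (simp add: letters) (simp add: eval_nat_numeral algebra_simps)
  have 6: "S (k + 4) (- int k - 2) =
      - (y * r * t) * (P * (1 - y)) * (Q (k + 3) - q\<^sup>2 * A - q * (A - q\<^sup>2 * B))"
    using step[of "- int k - 2"] unfolding D pow
    by (simp add: letters) (simp add: eval_nat_numeral algebra_simps)
  \<comment> \<open>Against a middle letter the three positive d descend and the three negative d
    ascend. The positive sums add up to \<open>P * Q (k + 3)\<close>, the negative ones to -y times
    that, and the factor y on the former makes both cancel.\<close>
  have 7: "S (k + 4) c = 0" if c: "\<bar>c\<bar> \<le> int (Suc k)" for c
  proof (cases c "0 :: int" rule: linorder_cases)
    case less
    then show ?thesis
      using step[of c] c
      by (simp add: letters) (simp add: eval_nat_numeral algebra_simps)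
  next
    case equal
    then show ?thesis
      by (simp add: last_sum_outside last_letters_def)
  next
    case greater
    then show ?thesis
      using step[of c] c
      by (simp add: letters) (simp add: eval_nat_numeral algebra_simps)
  qed
  have idx: "Suc k + 3 = k + 4" "Suc k + 2 = k + 3" "Suc k + 1 = k + 2"
    "int (Suc k) + 3 = int k + 4" "int (Suc k) + 2 = int k + 3" "int (Suc k) + 1 = int k + 2"
    "- int (Suc k) - 3 = - int k - 4" "- int (Suc k) - 2 = - int k - 3"
    "- int (Suc k) - 1 = - int k - 2" "Q (Suc k) = B"
    by (simp_all add: B_def)
  show ?thesis
    unfolding top_sums_formula_def idx y_def[symmetric] A_def[symmetric] B_def[symmetric] y'
    using 1 2 3 4 5 6 7 by (intro conjI allI impI)
qed

section \<open>Closed form of the sum over the whole group\<close>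

lemma prod_step_var_Suc:
  "(\<Prod>i=3..<k + 4. 1 - xs i) = (\<Prod>i=3..<k + 3. 1 - xs i) * (1 - xs (k + 3))"
proof -
  have "k + 4 = Suc (k + 3)"
    by simp
  then show ?thesis
    by (simp only:) (rule prod.atLeastLessThan_Suc, simp)
qed

lemma top_sums_formula_general: "top_sums_formula k (\<Prod>i=3..<k + 3. 1 - xs i)"
proof (induction k)
  case 0
  then show ?case
    using top_sums_formula_0 by simp
next
  case (Suc k)
  have "Suc k + 3 = k + 4"
    by simp
  then show ?case
    using top_sums_formula_Suc[OF Suc] by (simp only: prod_step_var_Suc)
qed

text \<open>The positive letters contribute \<open>P * Q (k + 3)\<close> and the negative ones
  \<open>- xs (k + 3)\<close> times this, which produces the new factor of the product.\<close>

lemma total_ge_3: "total (k + 3) = (\<Prod>i=3..<k + 4. 1 - xs i) * Q (k + 3)"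
proof -
  define P where "P = (\<Prod>i=3..<k + 3. 1 - xs i)"
  have F: "top_sums_formula k P"
    unfolding P_def by (rule top_sums_formula_general)
  define y where "y = xs (k + 3)"
  define A where "A = Q (k + 2)"
  define B where "B = Q (k + 1)"
  define C where "C = Q k"
  note eqs = F[unfolded top_sums_formula_def, folded y_def A_def B_def C_def]
  have "total (k + 3) = P * A + q * P * (A - B) + q\<^sup>2 * P * (A - B - q * (B - C))
      - q\<^sup>2 * y * P * A - q * y * P * (A - q\<^sup>2 * B)
      - y * P * (A - q\<^sup>2 * B - q * (B - q\<^sup>2 * C))"
    using sum_top_sums[OF F, of "\<lambda>_. 1"] eqs unfolding total_def by (simp only: mult_1_right) simp
  also have "\<dots> = P * (1 - y) *
      ((1 + q + q\<^sup>2) * A - (q + q\<^sup>2 + q ^ 3) * B + q ^ 3 * C)"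
    by (simp add: power2_eq_square power3_eq_cube algebra_simps)
  also have "\<dots> = P * (1 - y) * Q (k + 3)"
    unfolding quad_factor_recurrence A_def B_def C_def ..
  finally show ?thesis
    by (simp only: P_def y_def prod_step_var_Suc)
qed

lemma total_1: "total 1 = 1 - t * q\<^sup>2 * v"
  using last_sum_outside[of 1 0 "- t" q xs] last_sum_small
  by (simp add: total_def atLeastAtMost_int_expand last_letters_def step_var_numeral power2_eq_square
      del: One_nat_def)

text \<open>Degree 2 lies below the range of the six-letter formula, so its four sums are added
  directly.\<close>

lemma total_2: "total 2 = Q 2"
proof -
  have "S 2 0 = 0"
    by (simp add: last_sum_outside last_letters_def)
  then show ?thesis
    by (simp add: total_def atLeastAtMost_int_expand last_sum_small step_var_numeral quad_factor_def
        del: One_nat_def)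
      (simp add: eval_nat_numeral algebra_simps)
qed

lemma total_eq:
  assumes "2 \<le> m"
  shows "total m = (\<Prod>i=3..m. 1 - xs i) * Q m"
proof (cases "m = 2")
  case True
  then show ?thesis
    using total_2 by simp
next
  case False
  define k where "k = m - 3"
  have "m = k + 3"
    using assms False by (simp add: k_def)
  moreover have "{3..<k + 4} = {3..k + 3}"
    by auto
  ultimately show ?thesis
    using total_ge_3[of k] by (simp only:)
qed

text \<open>For m = 1 the quadratic is the total times a surplus factor \<open>1 - xs 2\<close>; the
  extended product from 3 to 1 is the inverse of exactly this factor.\<close>

lemma quad_factor_1: "Q 1 = (1 - xs 2) * (1 - t * q\<^sup>2 * v)"
  unfolding quad_factor_def step_var_numeral
  by (simp add: power2_eq_square power3_eq_cube algebra_simps)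

end

section \<open>Specialization to rational functions in X and Z\<close>

lemma X_nonzero: "X \<noteq> 0"
  by (simp add: X_def)

text \<open>This permits division by the factor of index 2 when m = 1.\<close>

lemma one_minus_XZ_nonzero: "1 - X * Z \<noteq> 0"
proof -
  have "1 - X * Z = to_fract [:1, - [:0, 1:]:]"
    by (simp add: X_def Z_def one_pCons flip: to_fract_1 to_fract_mult to_fract_diff)
  then show ?thesis
    by simp
qed

section \<open>Membership in the polynomial ring Q[X,Z]\<close>

lemma QXZ_closed:
  "1 \<in> QXZ" "a \<in> QXZ \<Longrightarrow> b \<in> QXZ \<Longrightarrow> a + b \<in> QXZ"
  "a \<in> QXZ \<Longrightarrow> b \<in> QXZ \<Longrightarrow> a - b \<in> QXZ"
  "a \<in> QXZ \<Longrightarrow> b \<in> QXZ \<Longrightarrow> a * b \<in> QXZ"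
  unfolding QXZ_def
  by (auto simp: image_iff simp flip: to_fract_1 to_fract_add to_fract_diff to_fract_mult)

lemma QXZ_power: "a \<in> QXZ \<Longrightarrow> a ^ k \<in> QXZ"
  by (induction k) (auto intro: QXZ_closed)

lemma QXZ_prod: "(\<And>i. i \<in> A \<Longrightarrow> f i \<in> QXZ) \<Longrightarrow> (\<Prod>i\<in>A. f i) \<in> QXZ"
  by (induction A rule: infinite_finite_induct) (auto intro: QXZ_closed)

lemma X_in_QXZ: "X \<in> QXZ" and Z_in_QXZ: "Z \<in> QXZ"
  by (auto simp: QXZ_def X_def Z_def)

lemma X_powi_in_QXZ: "0 \<le> e \<Longrightarrow> X powi e \<in> QXZ"
  by (auto simp: power_int_def intro: QXZ_power X_in_QXZ)

lemma X_powi_sum: "finite A \<Longrightarrow> (\<Prod>i\<in>A. X powi f i) = X powi (\<Sum>i\<in>A. f i)"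
  by (induction A rule: finite_induct) (simp_all add: power_int_add X_nonzero)

text \<open>With this substitution the factor contributed by a descent at i becomes \<open>step_var\<close>, and
  \<open>- t\<close> and q are the factors per negative letter and per unit of length.\<close>

definition q_sub :: ratfun where "q_sub = X powi (- 1)"
definition t_sub :: "nat \<Rightarrow> nat \<Rightarrow> ratfun" where "t_sub m n = X powi (int m - int n)"
definition v_sub :: "nat \<Rightarrow> nat \<Rightarrow> ratfun" where
  "v_sub m n = X powi (int m * int n + 1 + int n - int m) * Z"

lemma X_powi_power: "(X powi e) ^ k = X powi (e * int k)"
  by (simp add: power_int_mult)

lemma step_var_X:
  "step_var q_sub (t_sub m n) (v_sub m n) i =
     X powi ((int m - int i) * (int n + int i) + 2 * int i + (int n - int m)) * Z"
proof -
  \<comment> \<open>The 1 in the exponent of \<open>v_sub\<close> cancels the constant term of -(i -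
    1)^2, whose linear term supplies the 2i coming from \<open>maj\<close>.\<close>
  have e: "- 1 * int (nat ((int i - 1)\<^sup>2)) + (int m - int n) * int i
      + (int m * int n + 1 + int n - int m) =
      (int m - int i) * (int n + int i) + 2 * int i + (int n - int m)"
    unfolding nat_0_le[OF zero_le_power2] by (simp add: power2_eq_square algebra_simps)
  show ?thesis
    unfolding step_var_def q_sub_def t_sub_def v_sub_def X_powi_power e[symmetric]
    by (simp only: power_int_add X_nonzero simp_thms mult.assoc)
qed

lemma quad_factor_X:
  "quad_factor q_sub (t_sub m n) (v_sub m n) m =
     X powi (2 * int m * int n - int m - int n + 1) * Z ^ 2
      - ((X + 1) * X ^ m - (X ^ m - X - 1) * X ^ n - X) * X powi (int m * int n - int m - int n) * Z
      + 1"
proof -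
  \<comment> \<open>With X^m, X^n and X^(mn) as independent nonzero names, the claim is an identity
    of rational expressions that clearing denominators settles.\<close>
  define a where "a = X ^ m"
  define b where "b = X ^ n"
  define c where "c = X ^ (m * n)"
  have nz: "X \<noteq> 0" "a \<noteq> 0" "b \<noteq> 0" "c \<noteq> 0"
    by (simp_all add: a_def b_def c_def X_nonzero)
  have q: "q_sub = 1 / X"
    by (simp add: q_sub_def power_int_minus field_simps)
  have qm: "q_sub ^ m = 1 / a" "q_sub ^ (2 * m) = 1 / a\<^sup>2" "q_sub ^ (2 * m + 1) = 1 / (a\<^sup>2 * X)"
    unfolding q by (simp_all add: a_def power_divide power_mult[symmetric] mult.commute)
  have t: "t_sub m n = a / b"
    by (simp add: t_sub_def a_def b_def power_int_diff X_nonzero)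
  have mn: "X powi (int m * int n) = c"
    by (simp add: c_def flip: of_nat_mult)
  have v: "v_sub m n = c * X * b / a * Z"
    by (simp add: v_sub_def a_def b_def power_int_diff power_int_add X_nonzero mn)
  have e1: "X powi (2 * int m * int n - int m - int n + 1) = c\<^sup>2 * X / (a * b)"
  proof -
    have "2 * int m * int n = int m * int n + int m * int n"
      by simp
    then show ?thesis
      by (simp only: power_int_diff power_int_add X_nonzero mn simp_thms)
        (simp add: a_def b_def power2_eq_square X_nonzero power_int_add power_int_diff mn)
  qed
  have e2: "X powi (int m * int n - int m - int n) = c / (a * b)"
    by (simp add: power_int_diff X_nonzero mn a_def b_def)
  show ?thesis
    unfolding quad_factor_def qm
    unfolding t v e1 e2 q a_def[symmetric] b_def[symmetric] using nz
    by (simp add: field_simps power2_eq_square power3_eq_cube)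
qed

text \<open>The factor -t supplies the sign and the exponent -(n - m) per negative letter, q the
  exponent -1 per unit of length, and the descents supply the rest.\<close>

lemma weight_X:
  "weight (- t_sub m n) q_sub (step_var q_sub (t_sub m n) (v_sub m n)) m w =
    (- 1) ^ neg m w * X powi (sigma m n w - int (cox_length m w) + 2 * int (maj m w)
      + (int n - int m) * (int (des m w) - int (neg m w))) * Z ^ des m w"
proof -
  have "finite (descents m w)"
    by (simp add: descents_def)
  then have "(\<Prod>i\<in>descents m w. step_var q_sub (t_sub m n) (v_sub m n) i) =
      X powi (\<Sum>i\<in>descents m w. (int m - int i) * (int n + int i) + 2 * int i + (int n - int m))
        * Z ^ des m w"
    by (simp add: step_var_X prod.distrib X_powi_sum des_def)
  also have "(\<Sum>i\<in>descents m w. (int m - int i) * (int n + int i) + 2 * int i + (int n - int m)) =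
      sigma m n w + 2 * int (maj m w) + (int n - int m) * int (des m w)"
    by (simp add: sum.distrib sigma_def maj_def des_def sum_distrib_left mult.commute)
  finally have p: "(\<Prod>i\<in>descents m w. step_var q_sub (t_sub m n) (v_sub m n) i) =
      X powi (sigma m n w + 2 * int (maj m w) + (int n - int m) * int (des m w)) * Z ^ des m w" .
  have e: "sigma m n w - int (cox_length m w) + 2 * int (maj m w)
      + (int n - int m) * (int (des m w) - int (neg m w)) =
      (int m - int n) * int (neg m w) + (- 1) * int (cox_length m w)
      + (sigma m n w + 2 * int (maj m w) + (int n - int m) * int (des m w))"
    by (simp add: algebra_simps)
  show ?thesis
    unfolding weight_def p e power_minus[of "t_sub m n"]
    unfolding t_sub_def q_sub_def X_powi_power
    by (simp only: power_int_add X_nonzero simp_thms mult.assoc)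
qed

lemma sum_weight_X:
  "(\<Sum>w\<in>hyperoct m. weight (- t_sub m n) q_sub (step_var q_sub (t_sub m n) (v_sub m n)) m w) =
    total q_sub (t_sub m n) (v_sub m n) m"
  using sum_weight_by_last[of "- t_sub m n" q_sub "step_var q_sub (t_sub m n) (v_sub m n)" m "\<lambda>_. 1"]
  by (simp add: total_def)

text \<open>In degree 1 the right-hand side of the theorem carries a denominator, so membership in
  \<open>QXZ\<close> is read off from this explicit total.\<close>

lemma total_1_X:
  assumes "1 \<le> n"
  shows "total q_sub (t_sub 1 n) (v_sub 1 n) 1 = 1 - X powi (int n - 1) * Z"
proof -
  have "int n - 1 = (int 1 - int n) + (- 1 * int 2) + (int 1 * int n + 1 + int n - int 1)"
    by simp
  then have "t_sub 1 n * q_sub\<^sup>2 * v_sub 1 n = X powi (int n - 1) * Z"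
    unfolding t_sub_def q_sub_def v_sub_def X_powi_power
    by (simp only: power_int_add X_nonzero simp_thms mult.assoc)
  then show ?thesis
    unfolding total_1 by simp
qed

theorem corollary1p13:
  fixes m n :: nat and \<delta> :: int
  assumes "1 \<le> m" and "m \<le> n"
  defines "\<delta> \<equiv> int n - int m"
  shows
    "(\<Sum>w\<in>hyperoct m. (- 1) ^ neg m w
        * X powi (sigma m n w - int (cox_length m w) + 2 * int (maj m w)
                  + \<delta> * (int (des m w) - int (neg m w)))
        * Z ^ des m w) \<in> QXZ \<and>
     (\<Sum>w\<in>hyperoct m. (- 1) ^ neg m w
        * X powi (sigma m n w - int (cox_length m w) + 2 * int (maj m w)
                  + \<delta> * (int (des m w) - int (neg m w)))
        * Z ^ des m w)
     = ext_prod 3 (int m)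
         (\<lambda>i. 1 - X powi ((int m - i) * (int n + i) + 2 * i + \<delta>) * Z)
       * (X powi (2 * int m * int n - int m - int n + 1) * Z ^ 2
          - ((X + 1) * X ^ m - (X ^ m - X - 1) * X ^ n - X)
              * X powi (int m * int n - int m - int n) * Z
          + 1)"
proof -
  let ?x = "step_var q_sub (t_sub m n) (v_sub m n)"
  let ?T = "total q_sub (t_sub m n) (v_sub m n) m"
  let ?Q = "quad_factor q_sub (t_sub m n) (v_sub m n) m"
  let ?f = "\<lambda>i. 1 - X powi ((int m - i) * (int n + i) + 2 * i + (int n - int m)) * Z"
  have f: "?f (int i) = 1 - ?x i" for i
    by (simp only: step_var_X)
  have "?T \<in> QXZ \<and> ?T = ext_prod 3 (int m) ?f * ?Q"
  proof (cases "m = 1")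
    case True
    \<comment> \<open>At m = 1, i = 2 the exponent is -(n + 2) + 4 + (n - 1) = 1 for every
      n.\<close>
    have "?x 2 = X * Z"
      unfolding step_var_X by (simp add: True)
    then have "1 - ?x 2 \<noteq> 0"
      using one_minus_XZ_nonzero by simp
    moreover have "?Q = (1 - ?x 2) * ?T"
      using quad_factor_1[of q_sub "t_sub 1 n" "v_sub 1 n"] total_1[of q_sub "t_sub 1 n" "v_sub 1 n"]
      unfolding True by simp
    moreover have "ext_prod 3 (int m) ?f = inverse (1 - ?x 2)"
      using f[of 2] by (simp add: ext_prod_def True)
    moreover have "?T \<in> QXZ"
      using total_1_X[of n] assms unfolding True
      by (auto intro!: QXZ_closed X_powi_in_QXZ Z_in_QXZ)
    ultimately show ?thesis
      by simp
  next
    case False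
    then have m: "2 \<le> m" "2 \<le> n"
      using assms by auto
    have "ext_prod 3 (int m) ?f = (\<Prod>i=3..int m. ?f i)"
      using m by (simp add: ext_prod_def)
    also have "\<dots> = (\<Prod>i=3..m. ?f (int i))"
      by (rule prod.reindex_bij_witness[of _ int nat]) auto
    also have "\<dots> = (\<Prod>i=3..m. 1 - ?x i)"
      by (simp only: f)
    finally have eq: "?T = ext_prod 3 (int m) ?f * ?Q" and P: "ext_prod 3 (int m) ?f = (\<Prod>i=3..m. ?f (int i))"
      using total_eq[OF m(1), of q_sub "t_sub m n" "v_sub m n"] by (simp_all only: f)
    \<comment> \<open>The exponent is nonnegative because i \<le> m \<le> n.\<close>
    have "?f (int i) \<in> QXZ" if "i \<in> {3..m}" for i
      using that assms(2) by (intro QXZ_closed X_powi_in_QXZ Z_in_QXZ) auto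
    then have "ext_prod 3 (int m) ?f \<in> QXZ"
      unfolding P by (rule QXZ_prod)
    moreover have "?Q \<in> QXZ"
    proof -
      have "int m + int n \<le> int m * int n"
      proof -
        \<comment> \<open>The exponent mn - m - n equals (m - 2)(n - 2) + (m - 2) + (n - 2).\<close>
        have "0 \<le> (int m - 2) * (int n - 2)" "0 \<le> int m - 2" "0 \<le> int n - 2"
          using m by simp_all
        then show ?thesis
          by (simp add: algebra_simps)
      qed
      then show ?thesis
        unfolding quad_factor_X
        by (intro QXZ_closed X_powi_in_QXZ Z_in_QXZ X_in_QXZ QXZ_power) auto
    qed
    ultimately show ?thesis
      unfolding eq by (auto intro: QXZ_closed)
  qed
  then show ?thesis
    unfolding \<delta>_def weight_X[symmetric] sum_weight_X quad_factor_X .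
qed

end
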